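(* Let $N,k,d\ge1$ be integers, $\eta>0$, $\lambda\ge0$, and let $L^1:\mathbb{R}^{k\times d}\to\mathbb{R}_{\ge0}$ be the (differentiable) training loss of the linear model. Consider the end-to-end update rule on $W_e\in\mathbb{R}^{k\times d}$: $$W_e^{(t+1)}=(1-\eta\lambda N)W_e^{(t)}-\eta\sum_{j=1}^N\big[W_e^{(t)}(W_e^{(t)})^\top\big]^{\frac{j-1}{N}}\cdot\frac{dL^1}{dW}(W_e^{(t)})\cdot\big[(W_e^{(t)})^\top W_e^{(t)}\big]^{\frac{N-j}{N}}.$$ This update rule can be written as $$\mathrm{vec}(W_e^{(t+1)})=(1-\eta\lambda N)\cdot\mathrm{vec}(W_e^{(t)})-\eta\cdot P_{W_e^{(t)}}\,\mathrm{vec}\Big(\frac{dL^1}{dW}(W_e^{(t)})\Big),$$ where $P_{W_e^{(t)}}\in\mathbb{R}^{kd\times kd}$ is a positive semidefinite preconditioning matrix depending on $W_e^{(t)}$, described as follows. Denote the singular values of $W_e^{(t)}$ by $\sigma_1,\dots,\sigma_{\max\{k,d\}}\in\mathbb{R}_{\ge0}$ (by definition $\sigma_r=0$ if $r>\min\{k,d\}$), and the corresponding left and right singular vectors by $\mathbf{u}_1,\dots,\mathbf{u}_k\in\mathbb{R}^k$ and $\mathbf{v}_1,\dots,\mathbf{v}_d\in\mathbb{R}^d$ respectively. Then the eigenvectors of $P_{W_e^{(t)}}$ are $$\mathrm{vec}(\mathbf{u}_r\mathbf{v}_{r'}^\top),\qquad r=1,\dots,k,\ r'=1,\dots,d,$$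 with corresponding eigenvalues $$\sum_{j=1}^N\sigma_r^{2\frac{N-j}{N}}\sigma_{r'}^{2\frac{j-1}{N}},\qquad r=1,\dots,k,\ r'=1,\dots,d.$$
   Context: Training loss: given training data $(\mathbf{x}^{(i)},\mathbf{y}^{(i)})\in\mathbb{R}^d\times\mathbb{R}^k$, $i=1,\dots,m$, and a point-wise loss $l:\mathbb{R}^k\times\mathbb{R}^k\to\mathbb{R}_{\ge0}$ (such that the gradient exists), $L^1(W):=\frac1m\sum_{i=1}^m l(W\mathbf{x}^{(i)},\mathbf{y}^{(i)})$. $\frac{dL^1}{dW}(W)$ is the $k\times d$ matrix of partial derivatives of $L^1$ with respect to the entries of $W$. For an arbitrary matrix $A$, $\mathrm{vec}(A)$ is its arrangement as a vector in column-first order (columns stacked on top of each other). The singular vectors come from a full singular value decomposition $W_e^{(t)}=UDV^\top$ with $U\in\mathbb{R}^{k\times k}$ and $V\in\mathbb{R}^{d\times d}$ orthogonal, having columns $\mathbf{u}_r$ and $\mathbf{v}_{r'}$, and $D$ rectangular-diagonal with the singular values on its diagonal. Fractional powers: for a real symmetric positive semidefinite matrix $A=Q\,\mathrm{diag}(a_1,\dots,a_n)Q^\top$ ($Q$ orthogonal, $a_i\ge0$) and $s\ge0$, $[A]^s:=Q\,\mathrm{diag}(a_1^s,\dots,a_n^s)Q^\top$, with $[A]^0$ the identity matrix; correspondingly $0^0=1$ for scalars. *)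

theory Defs
  imports "HOL-Analysis.Analysis"
begin

text \<open>
  Matrices in $R^{k \times d}$ are rendered as \<open>real^'d^'k\<close> over arbitrary finite, linearly
  ordered index types. The order is only used to number the indices, as \<open>1, ..., CARD('n)\<close>;
  rectangular-diagonal matrices need this because rows and columns have different index types.
\<close>

definition pos :: "'n::{finite,linorder} \<Rightarrow> nat" where
  "pos i = card {j. j \<le> i}"

lemma bij_betw_pos: "bij_betw (pos :: 'n::{finite,linorder} \<Rightarrow> nat) UNIV {1..CARD('n)}"
proof -
  have "pos i < pos j" if "i < j" for i j :: 'n
  proof -
    have "j \<in> {a. a \<le> j} - {a. a \<le> i}" using that by auto
    moreover have "{a. a \<le> i} \<subseteq> {a. a \<le> j}" using that by auto
    ultimately have "{a. a \<le> i} \<subset> {a. a \<le> j}" by blast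
    then show ?thesis unfolding pos_def by (intro psubset_card_mono) simp_all
  qed
  then have inj: "inj (pos :: 'n \<Rightarrow> nat)"
    by (metis injI less_irrefl linorder_neqE)
  have "pos i \<in> {1..CARD('n)}" for i :: 'n
  proof -
    have "card {i} \<le> pos i" unfolding pos_def by (intro card_mono) auto
    moreover have "pos i \<le> CARD('n)" unfolding pos_def by (intro card_mono) auto
    ultimately show ?thesis by simp
  qed
  then have "range (pos :: 'n \<Rightarrow> nat) \<subseteq> {1..CARD('n)}" by blast
  moreover have "card (range (pos :: 'n \<Rightarrow> nat)) = card {1..CARD('n)}"
    using inj by (simp add: card_image)
  ultimately show ?thesis
    using inj by (simp add: bij_betw_def card_subset_eq)
qed

definition training_loss ::
    "nat \<Rightarrow> (nat \<Rightarrow> real^'d) \<Rightarrow> (nat \<Rightarrow> real^'k) \<Rightarrow> (real^'k \<Rightarrow> real^'k \<Rightarrow> real) \<Rightarrow> real^'d^'k \<Rightarrow> real"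
  where "training_loss m x y l W = (1 / real m) * (\<Sum>i = 1..m. l (W *v x i) (y i))"

text \<open>The \<open>(i, j)\<close> entry is the derivative in the \<open>(i, j)\<close> entry of \<open>W\<close>, all others held fixed.\<close>

definition matrix_gradient :: "(real^'d^'k \<Rightarrow> real) \<Rightarrow> real^'d^'k \<Rightarrow> real^'d^'k" where
  "matrix_gradient L W =
    (\<chi> i j. deriv (\<lambda>s. L (\<chi> a b. if a = i \<and> b = j then s else W $ a $ b)) (W $ i $ j))"

text \<open>
  $R^{kd}$ is indexed by pairs (column, row). Numbering the pair \<open>(j, i)\<close> as
  \<open>(pos j - 1) * CARD('k) + pos i\<close> lists the columns one after the other, from top to bottom.
\<close>

definition vectorize :: "real^'d^'k \<Rightarrow> real^('d \<times> 'k)" where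
  "vectorize A = (\<chi> p. A $ snd p $ fst p)"

definition outer :: "real^'k \<Rightarrow> real^'d \<Rightarrow> real^'d^'k" where
  "outer u v = (\<chi> i j. u $ i * v $ j)"

definition diag :: "('n \<Rightarrow> real) \<Rightarrow> real^'n^'n" where
  "diag a = (\<chi> i j. if i = j then a i else 0)"

definition rect_diag :: "(nat \<Rightarrow> real) \<Rightarrow> real^('d::{finite,linorder})^('k::{finite,linorder})" where
  "rect_diag \<sigma> = (\<chi> i j. if pos i = pos j then \<sigma> (pos i) else 0)"

text \<open>Library \<open>powr\<close> has \<open>0 powr 0 = 0\<close>; here $0^0 = 1$ is required.\<close>

definition rpow :: "real \<Rightarrow> real \<Rightarrow> real" where
  "rpow a s = (if s = 0 then 1 else a powr s)"

definition psd_power :: "real^'n^'n \<Rightarrow> real \<Rightarrow> real^'n^'n" where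
  "psd_power A s = (THE B. \<exists>Q a. orthogonal_matrix Q \<and> (\<forall>i. 0 \<le> a i) \<and>
      A = Q ** diag a ** transpose Q \<and>
      B = Q ** diag (\<lambda>i. rpow (a i) s) ** transpose Q)"

text \<open>The singular values need not be sorted.\<close>

definition full_svd ::
    "real^('d::{finite,linorder})^('k::{finite,linorder}) \<Rightarrow>
     real^('k::{finite,linorder})^('k::{finite,linorder}) \<Rightarrow> (nat \<Rightarrow> real) \<Rightarrow>
     real^('d::{finite,linorder})^('d::{finite,linorder}) \<Rightarrow> bool"
  where "full_svd W U \<sigma> V \<longleftrightarrow>
    orthogonal_matrix U \<and> orthogonal_matrix V \<and>
    (\<forall>r \<in> {1..min CARD('k) CARD('d)}. 0 \<le> \<sigma> r) \<and>
    (\<forall>r \<in> {min CARD('k) CARD('d)<..max CARD('k) CARD('d)}. \<sigma> r = 0) \<and>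
    W = U ** rect_diag \<sigma> ** transpose V"

definition pos_semidefinite :: "real^'n^'n \<Rightarrow> bool" where
  "pos_semidefinite P \<longleftrightarrow> transpose P = P \<and> (\<forall>z. 0 \<le> z \<bullet> (P *v z))"

definition is_eigenvector :: "real^'n^'n \<Rightarrow> real^'n \<Rightarrow> real \<Rightarrow> bool" where
  "is_eigenvector P z c \<longleftrightarrow> z \<noteq> 0 \<and> P *v z = c *\<^sub>R z"

definition end_to_end_update ::
    "real \<Rightarrow> real \<Rightarrow> nat \<Rightarrow> (real^'d^'k \<Rightarrow> real) \<Rightarrow> real^'d^'k \<Rightarrow> real^'d^'k" where
  "end_to_end_update \<eta> lam N L W =
    (1 - \<eta> * lam * real N) *\<^sub>R W -
    \<eta> *\<^sub>R (\<Sum>j = 1..N.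
        psd_power (W ** transpose W) ((real j - 1) / real N)
        ** matrix_gradient L W
        ** psd_power (transpose W ** W) ((real N - real j) / real N))"

end

theory Submission
  imports Defs
begin

text \<open>
  The map \<open>G \<mapsto> S ** G ** T\<close> becomes, under vectorization, the Kronecker product of \<open>S\<close> and
  the transpose of \<open>T\<close>, so \<open>P\<close> is a sum of Kronecker products of powers of \<open>W ** transpose W\<close>
  and \<open>transpose W ** W\<close>. Powers of positive semidefinite matrices have square roots, and the
  Kronecker product of the square roots is a square root of the Kronecker product; hence \<open>P\<close> is
  positive semidefinite. A singular value decomposition of \<open>W\<close> diagonalises both families of
  powers at once, and tensor products of eigenvectors are eigenvectors of the Kronecker products.
\<close>

section \<open>Spectral theorem for real symmetric matrices\<close>

text \<open>A maximiser \<open>x\<close> of the Rayleigh quotient on the unit sphere of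
  \<open>S\<close> is an eigenvector: the residual \<open>v = f x - c x\<close> lies in
  \<open>S\<close> and is orthogonal to \<open>x\<close>, and unless it vanishes, moving from
  \<open>x\<close> towards \<open>v\<close> increases the quotient to first order. Working inside an
  invariant subspace allows reuse on orthogonal complements.\<close>

lemma self_adjoint_eigenvector_in_subspace:
  fixes f :: "'a::euclidean_space \<Rightarrow> 'a"
  assumes lin: "linear f" and adj: "\<And>x y. f x \<bullet> y = x \<bullet> f y"
    and S: "subspace S" and inv: "\<And>x. x \<in> S \<Longrightarrow> f x \<in> S"
    and z: "z \<in> S" "z \<noteq> 0"
  obtains x c where "x \<in> S" "norm x = 1" "f x = c *\<^sub>R x"
proof -
  have "compact (sphere 0 1 \<inter> S)"
    using S by (intro compact_Int_closed closed_subspace) auto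
  moreover have "z /\<^sub>R norm z \<in> sphere 0 1 \<inter> S"
    using z S by (auto simp: subspace_scale)
  moreover have "continuous_on (sphere 0 1 \<inter> S) (\<lambda>x. x \<bullet> f x)"
    using lin by (intro continuous_intros linear_continuous_on) (simp add: linear_linear)
  ultimately have "\<exists>x\<in>sphere 0 1 \<inter> S. \<forall>y\<in>sphere 0 1 \<inter> S. y \<bullet> f y \<le> x \<bullet> f x"
    using continuous_attains_sup[of "sphere 0 1 \<inter> S" "\<lambda>x. x \<bullet> f x"] by blast
  then obtain x where x: "x \<in> S" "norm x = 1"
    and max: "\<And>y. y \<in> S \<Longrightarrow> norm y = 1 \<Longrightarrow> y \<bullet> f y \<le> x \<bullet> f x"
    by auto
  define c where "c = x \<bullet> f x"
  \<comment> \<open>Homogeneity extends the maximum from the sphere to all of \<open>S\<close>, so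
    the perturbed vector \<open>x + t v\<close> need not be normalised.\<close>
  have bound: "w \<bullet> f w \<le> c * (w \<bullet> w)" if "w \<in> S" for w
  proof (cases "w = 0")
    case False
    have "(w /\<^sub>R norm w) \<bullet> f (w /\<^sub>R norm w) \<le> c"
      unfolding c_def using False that S by (intro max) (auto simp: subspace_scale)
    then have "(w \<bullet> f w) / (norm w)\<^sup>2 \<le> c"
      by (simp add: linear_scale[OF lin] power2_eq_square field_simps)
    with False show ?thesis
      by (simp add: pos_divide_le_eq power2_norm_eq_inner)
  qed (simp add: linear_0[OF lin])
  define v where "v = f x - c *\<^sub>R x"
  have xx: "x \<bullet> x = 1"
    using x(2) by (simp add: norm_eq_1)
  have vS: "v \<in> S"
    unfolding v_def using x(1) S inv by (simp add: subspace_diff subspace_scale)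
  have vx: "v \<bullet> x = 0"
    by (simp add: v_def inner_diff_left inner_diff_right xx c_def inner_commute)
  have fxv: "f x \<bullet> v = v \<bullet> v"
    using vx by (simp add: v_def inner_diff_left inner_commute)
  have xfv: "x \<bullet> f v = v \<bullet> v"
    using fxv adj by simp
  define K where "K = c * (v \<bullet> v) - v \<bullet> f v"
  \<comment> \<open>First-order optimality of \<open>x\<close> in the direction \<open>v\<close>.\<close>
  have quad: "2 * t * (v \<bullet> v) \<le> t\<^sup>2 * K" for t :: real
  proof -
    have "(x + t *\<^sub>R v) \<bullet> f (x + t *\<^sub>R v) \<le> c * ((x + t *\<^sub>R v) \<bullet> (x + t *\<^sub>R v))"
      using x(1) vS S by (intro bound) (simp add: subspace_add subspace_scale)
    moreover have "(x + t *\<^sub>R v) \<bullet> f (x + t *\<^sub>R v) = c + 2 * t * (v \<bullet> v) + t\<^sup>2 * (v \<bullet> f v)"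
      using fxv xfv
      by (simp add: linear_add[OF lin] linear_scale[OF lin] inner_add_left inner_add_right
          c_def power2_eq_square algebra_simps inner_commute[of v "f x"])
    moreover have "(x + t *\<^sub>R v) \<bullet> (x + t *\<^sub>R v) = 1 + t\<^sup>2 * (v \<bullet> v)"
      using vx xx
      by (simp add: inner_add_left inner_add_right power2_eq_square inner_commute[of x v])
    ultimately have "c + 2 * t * (v \<bullet> v) + t\<^sup>2 * (v \<bullet> f v) \<le> c * (1 + t\<^sup>2 * (v \<bullet> v))"
      by (simp only:)
    then show ?thesis
      by (simp add: K_def algebra_simps)
  qed
  \<comment> \<open>In \<open>quad\<close> the left side is linear in \<open>t\<close> and the right
    side quadratic. For \<open>K > 0\<close> the choice \<open>t = (v \<bullet> v) / K\<close>
    leaves twice a nonnegative number below itself; otherwise \<open>t = 1\<close> suffices.\<close>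
  have "v \<bullet> v \<le> 0"
  proof (cases "K > 0")
    case True
    have "2 * ((v \<bullet> v)\<^sup>2 / K) \<le> (v \<bullet> v)\<^sup>2 / K"
      using quad[of "(v \<bullet> v) / K"] True by (simp add: power2_eq_square)
    then have "(v \<bullet> v)\<^sup>2 / K \<le> 0" by linarith
    then have "(v \<bullet> v)\<^sup>2 \<le> 0"
      using True by (simp only: divide_le_0_iff) auto
    then show ?thesis by simp
  next
    case False
    then show ?thesis using quad[of 1] by simp
  qed
  then have "v = 0" by (metis inner_eq_zero_iff inner_ge_zero order_antisym)
  then show thesis
    using that[of x c] x by (simp add: v_def)
qed

text \<open>Induction on \<open>n\<close>: the orthogonal complement of the eigenvectors found so
  far is invariant because \<open>f\<close> is self-adjoint, and nonzero because there are fewer of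
  them than the dimension. It therefore contains a further unit eigenvector.\<close>

lemma self_adjoint_orthonormal_eigenvectors:
  fixes f :: "'a::euclidean_space \<Rightarrow> 'a"
  assumes lin: "linear f" and adj: "\<And>x y. f x \<bullet> y = x \<bullet> f y"
  shows "n \<le> DIM('a) \<Longrightarrow> \<exists>B. finite B \<and> card B = n \<and> pairwise orthogonal B \<and>
    (\<forall>b\<in>B. norm b = 1 \<and> (\<exists>c. f b = c *\<^sub>R b))"
proof (induction n)
  case 0
  show ?case by (intro exI[of _ "{}"]) simp
next
  case (Suc n)
  then obtain B where B: "finite B" "card B = n" "pairwise orthogonal B"
    "\<And>b. b \<in> B \<Longrightarrow> norm b = 1" "\<And>b. b \<in> B \<Longrightarrow> \<exists>c. f b = c *\<^sub>R b"
    by auto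
  define S where "S = {y. \<forall>b\<in>B. b \<bullet> y = 0}"
  have "subspace S"
    by (auto simp: S_def subspace_def inner_add_right)
  moreover have "f y \<in> S" if "y \<in> S" for y
  proof -
    have "b \<bullet> f y = 0" if "b \<in> B" for b
    proof -
      obtain c where "f b = c *\<^sub>R b" using B(5) \<open>b \<in> B\<close> by blast
      then show ?thesis using adj[of b y] \<open>y \<in> S\<close> that by (simp add: S_def)
    qed
    then show ?thesis by (simp add: S_def)
  qed
  moreover obtain z where "z \<in> S" "z \<noteq> 0"
  proof -
    have "dim B < DIM('a)"
      using dim_le_card'[OF B(1)] B(2) Suc.prems by linarith
    then obtain z where "z \<noteq> 0" "\<And>y. y \<in> span B \<Longrightarrow> orthogonal z y"
      using orthogonal_to_subspace_exists by blast
    then show thesis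
      using that[of z] by (auto simp: S_def orthogonal_def span_base inner_commute)
  qed
  ultimately obtain x c where x: "x \<in> S" "norm x = 1" "f x = c *\<^sub>R x"
    using self_adjoint_eigenvector_in_subspace[OF lin adj] by metis
  have "x \<notin> B"
    using x(1,2) by (auto simp: S_def)
  moreover have "pairwise orthogonal (insert x B)"
    using B(3) x(1) by (auto simp: pairwise_insert S_def orthogonal_def inner_commute)
  ultimately show ?case
    using B x by (intro exI[of _ "insert x B"]) auto
qed

section \<open>Diagonal matrices and orthogonal diagonalization\<close>

lemma matrix_diag_component [simp]: "(A ** diag a) $ i $ j = A $ i $ j * a j"
  by (simp add: matrix_matrix_mult_def diag_def if_distrib[of "(*) _"] cong: if_cong)

lemma diag_matrix_component [simp]: "(diag a ** A) $ i $ j = a i * A $ i $ j"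
  by (simp add: matrix_matrix_mult_def diag_def if_distrib[of "\<lambda>x. x * _"] cong: if_cong)

lemma diag_mult_diag: "diag a ** diag b = diag (\<lambda>i. a i * b i)"
  by (auto simp: vec_eq_iff) (simp_all add: diag_def)

lemma transpose_diag [simp]: "transpose (diag a) = diag a"
  by (auto simp: vec_eq_iff transpose_def diag_def)

lemma symmetric_matrix_diagonalization:
  fixes A :: "real^'n^'n"
  assumes "transpose A = A"
  obtains Q a where "orthogonal_matrix Q" "A = Q ** diag a ** transpose Q"
proof -
  have adj: "(A *v x) \<bullet> y = x \<bullet> (A *v y)" for x y
    by (metis assms dot_lmul_matrix transpose_matrix_vector)
  have "CARD('n) \<le> DIM(real^'n)" by simp
  from self_adjoint_orthonormal_eigenvectors[OF matrix_vector_mul_linear adj this]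
  obtain B where B: "finite B" "card B = CARD('n)" "pairwise orthogonal B"
    "\<forall>b\<in>B. norm b = 1 \<and> (\<exists>c. A *v b = c *\<^sub>R b)"
    by blast
  obtain \<beta> where \<beta>: "bij_betw \<beta> (UNIV :: 'n set) B"
    using finite_same_card_bij[OF finite_class.finite_UNIV B(1)] B(2) by metis
  then have \<beta>B: "\<beta> i \<in> B" for i by (auto simp: bij_betw_def)
  have "\<forall>i. \<exists>c. A *v \<beta> i = c *\<^sub>R \<beta> i"
    using B(4) \<beta>B by blast
  then obtain a where a: "\<And>i. A *v \<beta> i = a i *\<^sub>R \<beta> i"
    by metis
  have \<beta>\<beta>: "\<beta> i \<bullet> \<beta> j = (if i = j then 1 else 0)" for i j
  proof (cases "i = j")
    case True
    then show ?thesis using B(4) \<beta>B by (simp add: norm_eq_1)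
  next
    case False
    then have "\<beta> i \<noteq> \<beta> j" using \<beta> by (auto simp: bij_betw_def inj_def)
    then show ?thesis
      using B(3) \<beta>B False by (simp add: pairwise_def orthogonal_def)
  qed
  define Q where "Q = (\<chi> i j. \<beta> j $ i)"
  have "transpose Q ** Q = mat 1"
    using \<beta>\<beta> by (simp add: vec_eq_iff matrix_matrix_mult_def transpose_def Q_def inner_vec_def mat_def)
  then have Q: "orthogonal_matrix Q" by (simp add: orthogonal_matrix)
  have "A ** Q = Q ** diag a"
  proof -
    have "(A ** Q) $ i $ j = (A *v \<beta> j) $ i" for i j
      by (simp add: matrix_matrix_mult_def matrix_vector_mult_def Q_def)
    then show ?thesis
      using a by (simp add: vec_eq_iff) (simp add: Q_def)
  qed
  then have "A = Q ** diag a ** transpose Q"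
    using Q by (metis matrix_mul_assoc matrix_mul_rid orthogonal_matrix_def)
  with Q show thesis by (rule that)
qed

section \<open>Powers of positive semidefinite matrices\<close>

text \<open>This makes \<open>psd_power\<close> well defined. The matrix \<open>M\<close> of change
  between the two eigenbases satisfies \<open>M $ i $ j * a j = b i * M $ i $ j\<close>, so
  \<open>a j = b i\<close> wherever the entry of \<open>M\<close> is nonzero. Applying
  \<open>f\<close> to the eigenvalues preserves this relation, so multiplicities and orderings never
  have to be compared.\<close>

lemma diagonalization_transfer:
  fixes Q R :: "real^'n^'n"
  assumes Q: "orthogonal_matrix Q" and R: "orthogonal_matrix R"
    and eq: "Q ** diag a ** transpose Q = R ** diag b ** transpose R"
  shows "Q ** diag (\<lambda>i. f (a i)) ** transpose Q = R ** diag (\<lambda>i. f (b i)) ** transpose R"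
proof -
  have QR: "transpose Q ** Q = mat 1" "Q ** transpose Q = mat 1"
    "transpose R ** R = mat 1" "R ** transpose R = mat 1"
    using Q R by (auto simp: orthogonal_matrix_def)
  define M where "M = transpose R ** Q"
  have "M ** diag a = transpose R ** (Q ** diag a ** transpose Q) ** Q"
    by (metis M_def QR(1) matrix_mul_assoc matrix_mul_rid)
  also have "\<dots> = diag b ** M"
    by (metis M_def eq QR(3) matrix_mul_assoc matrix_mul_lid)
  finally have "M $ i $ j * a j = b i * M $ i $ j" for i j
    by (metis matrix_diag_component diag_matrix_component)
  then have "M $ i $ j = 0 \<or> a j = b i" for i j
    by (metis mult.commute mult_cancel_left)
  then have "M ** diag (\<lambda>i. f (a i)) = diag (\<lambda>i. f (b i)) ** M"
    unfolding vec_eq_iff by (metis matrix_diag_component diag_matrix_component mult.commute mult_zero_left)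
  then have "R ** (M ** diag (\<lambda>i. f (a i))) ** transpose Q =
      R ** (diag (\<lambda>i. f (b i)) ** M) ** transpose Q"
    by simp
  then show ?thesis
    unfolding M_def by (metis QR(2,4) matrix_mul_assoc matrix_mul_lid matrix_mul_rid)
qed

text \<open>Resolves the definite description: any one diagonalization witnesses existence, and
  \<open>diagonalization_transfer\<close> gives uniqueness.\<close>

lemma psd_power_diagonalization:
  fixes Q :: "real^'n^'n"
  assumes "orthogonal_matrix Q" "\<And>i. 0 \<le> a i" "A = Q ** diag a ** transpose Q"
  shows "psd_power A s = Q ** diag (\<lambda>i. rpow (a i) s) ** transpose Q"
  unfolding psd_power_def
proof (rule the_equality)
  show "\<exists>R b. orthogonal_matrix R \<and> (\<forall>i. 0 \<le> b i) \<and> A = R ** diag b ** transpose R \<and>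
      Q ** diag (\<lambda>i. rpow (a i) s) ** transpose Q =
      R ** diag (\<lambda>i. rpow (b i) s) ** transpose R"
    using assms by blast
next
  fix B
  assume "\<exists>R b. orthogonal_matrix R \<and> (\<forall>i. 0 \<le> b i) \<and> A = R ** diag b ** transpose R \<and>
      B = R ** diag (\<lambda>i. rpow (b i) s) ** transpose R"
  then show "B = Q ** diag (\<lambda>i. rpow (a i) s) ** transpose Q"
    using diagonalization_transfer[where f = "\<lambda>x. rpow x s"] assms by metis
qed

lemma rpow_nonneg: "0 \<le> rpow a s"
  by (simp add: rpow_def)

text \<open>Converts eigenvalues of the Gram matrices, which are squared singular values, into the
  exponents of the claim. At \<open>a = 0\<close> both sides are 1 for \<open>s = 0\<close> and 0
  otherwise.\<close>

lemma rpow_square: "0 \<le> a \<Longrightarrow> rpow (a\<^sup>2) s = rpow a (2 * s)"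
  by (cases "a = 0") (simp_all add: rpow_def powr_powr flip: powr_numeral)

text \<open>Each \<open>a i\<close> is a diagonal entry of \<open>C ** transpose C\<close> with
  \<open>C = transpose Q ** B\<close>, hence a sum of squares.\<close>

lemma gram_matrix_diagonalization:
  fixes B :: "real^'m^'n"
  obtains Q a where "orthogonal_matrix Q" "\<And>i. 0 \<le> a i"
    "B ** transpose B = Q ** diag a ** transpose Q"
proof -
  have "transpose (B ** transpose B) = B ** transpose B"
    by (simp add: matrix_transpose_mul)
  then obtain Q a where Q: "orthogonal_matrix Q" "B ** transpose B = Q ** diag a ** transpose Q"
    by (rule symmetric_matrix_diagonalization)
  have "0 \<le> a i" for i
  proof -
    define C where "C = transpose Q ** B"
    have "diag a = transpose Q ** (Q ** diag a ** transpose Q) ** Q"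
      using Q(1) by (metis matrix_mul_assoc matrix_mul_lid matrix_mul_rid orthogonal_matrix_def)
    also have "\<dots> = C ** transpose C"
      unfolding C_def Q(2)[symmetric]
      by (simp add: matrix_transpose_mul matrix_mul_assoc)
    finally have "a i = (C ** transpose C) $ i $ i"
      by (metis (mono_tags, lifting) diag_def vec_lambda_beta)
    then show ?thesis
      by (simp add: matrix_matrix_mult_def transpose_def sum_nonneg)
  qed
  with Q show thesis by (intro that)
qed

lemma psd_power_gram_factorization:
  fixes B :: "real^'m^'n"
  obtains C :: "real^'n^'n" where "psd_power (B ** transpose B) s = C ** transpose C"
proof -
  obtain Q a where Q: "orthogonal_matrix Q" "\<And>i. 0 \<le> a i"
    "B ** transpose B = Q ** diag a ** transpose Q"
    using gram_matrix_diagonalization[of B] by metis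
  \<comment> \<open>Only \<open>C ** transpose C\<close> matters, so the right-hand factor
    \<open>transpose Q\<close> of the symmetric square root is dropped.\<close>
  define C where "C = Q ** diag (\<lambda>i. sqrt (rpow (a i) s))"
  have "C ** transpose C =
      Q ** (diag (\<lambda>i. sqrt (rpow (a i) s)) ** diag (\<lambda>i. sqrt (rpow (a i) s))) ** transpose Q"
    by (simp add: C_def matrix_transpose_mul matrix_mul_assoc)
  also have "\<dots> = psd_power (B ** transpose B) s"
    by (simp add: diag_mult_diag rpow_nonneg psd_power_diagonalization[OF Q])
  finally show thesis by (rule that[of C, OF sym])
qed

lemma psd_power_transpose_gram_factorization:
  fixes B :: "real^'m^'n"
  obtains C :: "real^'m^'m" where "psd_power (transpose B ** B) s = C ** transpose C"
  using psd_power_gram_factorization[of "transpose B"] by auto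

lemma matrix_vector_mult_column: "A *v column r B = column r (A ** B)"
  by (simp add: vec_eq_iff column_def matrix_vector_mult_def matrix_matrix_mult_def)

lemma diagonalization_eigenvector:
  fixes Q :: "real^'n^'n"
  assumes "orthogonal_matrix Q"
  shows "(Q ** diag a ** transpose Q) *v column r Q = a r *\<^sub>R column r Q"
proof -
  have "Q ** diag a ** transpose Q ** Q = Q ** diag a"
    using assms by (metis matrix_mul_assoc matrix_mul_rid orthogonal_matrix_def)
  then show ?thesis
    by (simp add: matrix_vector_mult_column) (simp add: vec_eq_iff column_def)
qed

section \<open>Kronecker products\<close>

text \<open>Index pairs are (column, row), as in \<open>vectorize\<close>: \<open>S\<close> acts on
  rows and \<open>T\<close> on columns. In column-first numbering this is the textbook Kronecker
  product with \<open>T\<close> as the left factor.\<close>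

definition kronecker :: "real^'a^'b \<Rightarrow> real^'c^'e \<Rightarrow> real^('c \<times> 'a)^('e \<times> 'b)" where
  "kronecker S T = (\<chi> p q. S $ snd p $ snd q * T $ fst p $ fst q)"

lemma kronecker_mult: "kronecker S T ** kronecker S' T' = kronecker (S ** S') (T ** T')"
  \<comment> \<open>The universe of a pair type is rewritten to a product of universes, the shape to
    which \<open>sum.cartesian_product\<close> collapses nested sums; the forward rule
    \<open>UNIV_Times_UNIV\<close> would undo this.\<close>
  by (simp add: vec_eq_iff kronecker_def matrix_matrix_mult_def sum_product
      sum.cartesian_product case_prod_unfold UNIV_Times_UNIV[symmetric]
      sum.swap[of _ "UNIV :: 'g set"] mult_ac del: UNIV_Times_UNIV)

lemma transpose_kronecker: "transpose (kronecker S T) = kronecker (transpose S) (transpose T)"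
  by (simp add: vec_eq_iff kronecker_def transpose_def)

lemma kronecker_vectorize: "kronecker S T *v vectorize A = vectorize (S ** A ** transpose T)"
  by (simp add: vec_eq_iff kronecker_def matrix_matrix_mult_def matrix_vector_mult_def
      vectorize_def transpose_def sum_distrib_right sum_distrib_left
      sum.cartesian_product case_prod_unfold UNIV_Times_UNIV[symmetric] mult_ac
      del: UNIV_Times_UNIV)

lemma kronecker_vectorize_outer:
  "kronecker S T *v vectorize (outer u v) = vectorize (outer (S *v u) (T *v v))"
proof -
  have "S ** outer u v ** transpose T = outer (S *v u) (T *v v)"
    by (simp add: vec_eq_iff matrix_matrix_mult_def matrix_vector_mult_def outer_def
        transpose_def sum_distrib_left sum_distrib_right mult_ac)
       (intro allI sum.swap)
  then show ?thesis by (simp add: kronecker_vectorize)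
qed

lemma vectorize_outer_scaleR:
  "vectorize (outer (a *\<^sub>R u) (b *\<^sub>R v)) = (a * b) *\<^sub>R vectorize (outer u v)"
  by (simp add: vec_eq_iff vectorize_def outer_def)

text \<open>The Frobenius inner product of rank-one matrices factorises. Orthonormality of the
  singular vectors thus passes to their tensor products.\<close>

lemma inner_vectorize_outer:
  "vectorize (outer u v) \<bullet> vectorize (outer u' v') = (u \<bullet> u') * (v \<bullet> v')"
  by (simp add: inner_vec_def vectorize_def outer_def sum_product sum.cartesian_product
      case_prod_unfold UNIV_Times_UNIV[symmetric] mult_ac sum.swap[of _ "UNIV :: 'b set"]
      del: UNIV_Times_UNIV)

lemma linear_vectorize: "linear vectorize"
  by (rule linearI) (simp_all add: vec_eq_iff vectorize_def)

lemma inj_vectorize: "inj vectorize"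
  by (rule injI) (auto simp: vec_eq_iff vectorize_def)

lemma pos_semidefinite_mult_transpose: "pos_semidefinite (M ** transpose M)"
  unfolding pos_semidefinite_def
proof (intro conjI allI)
  show "transpose (M ** transpose M) = M ** transpose M"
    by (simp add: matrix_transpose_mul)
  fix z
  have "z \<bullet> ((M ** transpose M) *v z) = (z v* M) \<bullet> (z v* M)"
    by (simp add: dot_lmul_matrix flip: matrix_vector_mul_assoc)
  then show "0 \<le> z \<bullet> ((M ** transpose M) *v z)" by simp
qed

lemma sum_matrix_vector_mult: "(\<Sum>j\<in>J. A j) *v z = (\<Sum>j\<in>J. A j *v z)"
  by (induction J rule: infinite_finite_induct) (simp_all add: matrix_vector_mult_add_rdistrib)

lemma pos_semidefinite_sum:
  assumes "\<And>j. j \<in> J \<Longrightarrow> pos_semidefinite (A j)"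
  shows "pos_semidefinite (\<Sum>j\<in>J. A j)"
  unfolding pos_semidefinite_def
proof (intro conjI allI)
  have "A j $ b $ a = A j $ a $ b" if "j \<in> J" for j a b
    using assms[OF that] by (auto simp: pos_semidefinite_def vec_eq_iff transpose_def)
  then show "transpose (\<Sum>j\<in>J. A j) = (\<Sum>j\<in>J. A j)"
    by (simp add: vec_eq_iff transpose_def)
  show "0 \<le> z \<bullet> ((\<Sum>j\<in>J. A j) *v z)" for z
    using assms by (auto simp: sum_matrix_vector_mult inner_sum_right pos_semidefinite_def
        intro!: sum_nonneg)
qed

section \<open>The preconditioner\<close>

text \<open>By \<open>kronecker_vectorize\<close>, right multiplication by a matrix enters the
  Kronecker product through its transpose. The second factor stands untransposed because this power
  is symmetric (\<open>transpose_psd_power_gram\<close>).\<close>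

definition preconditioner :: "nat \<Rightarrow> real^'d^'k \<Rightarrow> real^('d \<times> 'k)^('d \<times> 'k)" where
  "preconditioner N W = (\<Sum>j = 1..N.
     kronecker (psd_power (W ** transpose W) ((real j - 1) / real N))
               (psd_power (transpose W ** W) ((real N - real j) / real N)))"

lemma pos_semidefinite_preconditioner:
  fixes W :: "real^'d^'k"
  shows "pos_semidefinite (preconditioner N W)"
  unfolding preconditioner_def
proof (rule pos_semidefinite_sum)
  fix j
  obtain C :: "real^'k^'k" where C: "psd_power (W ** transpose W) ((real j - 1) / real N) = C ** transpose C"
    by (rule psd_power_gram_factorization)
  obtain D :: "real^'d^'d" where D: "psd_power (transpose W ** W) ((real N - real j) / real N) = D ** transpose D"
    by (rule psd_power_transpose_gram_factorization)
  show "pos_semidefinite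
      (kronecker (psd_power (W ** transpose W) ((real j - 1) / real N))
        (psd_power (transpose W ** W) ((real N - real j) / real N)))"
    \<comment> \<open>Read backwards, the product and transpose rules exhibit the summand as
      \<open>M ** transpose M\<close> with \<open>M = kronecker C D\<close>.\<close>
    unfolding C D kronecker_mult[symmetric] transpose_kronecker[symmetric]
    by (rule pos_semidefinite_mult_transpose)
qed

lemma transpose_psd_power_gram:
  "transpose (psd_power (transpose W ** W) s) = psd_power (transpose W ** W) s"
  using psd_power_transpose_gram_factorization[of W s] by (metis matrix_transpose_mul transpose_transpose)

lemma vectorize_end_to_end_update:
  "vectorize (end_to_end_update \<eta> lam N L W) =
    (1 - \<eta> * lam * real N) *\<^sub>R vectorize W
    - \<eta> *\<^sub>R (preconditioner N W *v vectorize (matrix_gradient L W))"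
  by (simp add: end_to_end_update_def preconditioner_def sum_matrix_vector_mult
      kronecker_vectorize transpose_psd_power_gram linear_diff[OF linear_vectorize]
      linear_scale[OF linear_vectorize] linear_sum[OF linear_vectorize])

section \<open>Singular value decompositions and the spectrum of the preconditioner\<close>

text \<open>Exchanges left and right singular vectors, so that results about
  \<open>W ** transpose W\<close> and \<open>U\<close> also serve \<open>transpose W ** W\<close>
  and \<open>V\<close>.\<close>

lemma full_svd_transpose:
  assumes "full_svd W U \<sigma> V"
  shows "full_svd (transpose W) V \<sigma> U"
proof -
  have "transpose (rect_diag \<sigma> :: real^('a::{finite,linorder})^('b::{finite,linorder})) = rect_diag \<sigma>"
    by (auto simp: vec_eq_iff transpose_def rect_diag_def)
  then show ?thesis
    using assms by (auto simp: full_svd_def matrix_transpose_mul matrix_mul_assoc min.commute max.commute)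
qed

lemma pos_in_range: "pos (i :: 'n::{finite,linorder}) \<in> {1..CARD('n)}"
  using bij_betw_pos[where 'n = 'n] by (auto simp: bij_betw_def)

lemma pos_eq_iff: "pos i = pos j \<longleftrightarrow> i = j"
  using bij_betw_pos by (auto simp: bij_betw_def inj_on_def)

text \<open>If \<open>pos i\<close> is at most \<open>CARD('d)\<close>, exactly one column meets row
  \<open>i\<close> on the diagonal and the sum has one possibly nonzero term. Beyond that the row is
  zero, and the hypothesis makes \<open>\<sigma> (pos i)\<close> zero to match.\<close>

lemma rect_diag_mult_transpose:
  assumes "\<And>r. r \<in> {CARD('d::{finite,linorder})<..CARD('k::{finite,linorder})} \<Longrightarrow> \<sigma> r = 0"
  shows "(rect_diag \<sigma> :: real^('d::{finite,linorder})^('k::{finite,linorder})) ** transpose (rect_diag \<sigma>)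
    = diag (\<lambda>i. (\<sigma> (pos i))\<^sup>2)"
proof -
  have "(\<Sum>c\<in>(UNIV :: 'd set). (if pos i = pos c then \<sigma> (pos i) else 0) *
      (if pos j = pos c then \<sigma> (pos j) else 0)) = (if i = j then (\<sigma> (pos i))\<^sup>2 else 0)"
    (is "sum ?g _ = _") for i j :: 'k
  proof (cases "pos i \<in> {1..CARD('d)}")
    case True
    then obtain c where c: "pos i = pos (c :: 'd)"
      using bij_betw_pos[where 'n = 'd] unfolding bij_betw_def by (metis imageE)
    then have "pos i = pos c' \<longleftrightarrow> c' = c" for c' :: 'd
      by (auto simp: pos_eq_iff)
    then have "sum ?g UNIV = (\<Sum>c'\<in>UNIV. if c' = c then \<sigma> (pos i) *
        (if pos j = pos i then \<sigma> (pos j) else 0) else 0)"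
      using c by (intro sum.cong) auto
    then show ?thesis
      by (simp add: pos_eq_iff power2_eq_square eq_commute[of j i])
  next
    case False
    then have "\<sigma> (pos i) = 0"
      using pos_in_range[of i] by (intro assms) auto
    then show ?thesis by (simp cong del: if_weak_cong)
  qed
  then show ?thesis
    by (simp add: vec_eq_iff matrix_matrix_mult_def transpose_def rect_diag_def diag_def)
qed

text \<open>The factor \<open>transpose V ** V\<close> cancels in \<open>W ** transpose W\<close>,
  leaving a diagonalization by \<open>U\<close> with squared singular values. The columns of
  \<open>U\<close> are thus eigenvectors of every power at once.\<close>

lemma full_svd_psd_power_eigenvector:
  fixes W :: "real^('d::{finite,linorder})^('k::{finite,linorder})"
  assumes "full_svd W U \<sigma> V"
  shows "psd_power (W ** transpose W) s *v column r U = rpow (\<sigma> (pos r)) (2 * s) *\<^sub>R column r U"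
proof -
  have U: "orthogonal_matrix U" and V: "orthogonal_matrix V"
    and nonneg: "\<And>r. r \<in> {1..min CARD('k) CARD('d)} \<Longrightarrow> 0 \<le> \<sigma> r"
    and zero: "\<And>r. r \<in> {min CARD('k) CARD('d)<..max CARD('k) CARD('d)} \<Longrightarrow> \<sigma> r = 0"
    and W: "W = U ** rect_diag \<sigma> ** transpose V"
    using assms by (auto simp: full_svd_def)
  \<comment> \<open>When \<open>k\<close> exceeds \<open>d\<close>, positions beyond the minimum
    fall under the zero padding of the singular values.\<close>
  have \<sigma>: "0 \<le> \<sigma> (pos i)" for i :: 'k
    using nonneg[of "pos i"] zero[of "pos i"] pos_in_range[of i] by fastforce
  have "W ** transpose W =
      U ** rect_diag \<sigma> ** (transpose V ** V) ** transpose (rect_diag \<sigma>) ** transpose U"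
    by (simp add: W matrix_transpose_mul matrix_mul_assoc)
  also have "\<dots> = U ** (rect_diag \<sigma> ** transpose (rect_diag \<sigma> :: real^('d::{finite,linorder})^('k::{finite,linorder}))) ** transpose U"
    using V by (simp add: orthogonal_matrix_def matrix_mul_assoc)
  also have "\<dots> = U ** diag (\<lambda>i. (\<sigma> (pos i))\<^sup>2) ** transpose U"
    using zero by (subst rect_diag_mult_transpose) auto
  finally have "psd_power (W ** transpose W) s =
      U ** diag (\<lambda>i. rpow ((\<sigma> (pos i))\<^sup>2) s) ** transpose U"
    using U by (intro psd_power_diagonalization) simp_all
  then show ?thesis
    using U by (simp add: diagonalization_eigenvector rpow_square \<sigma>)
qed

lemma inner_columns_orthogonal_matrix:
  fixes Q :: "real^'n^'n"
  assumes "orthogonal_matrix Q"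
  shows "column i Q \<bullet> column j Q = (if i = j then 1 else 0)"
proof -
  have "column i Q \<bullet> column j Q = (transpose Q ** Q) $ i $ j"
    by (simp add: inner_vec_def column_def matrix_matrix_mult_def transpose_def)
  then show ?thesis
    using assms by (simp add: orthogonal_matrix_def mat_def)
qed

lemma full_svd_preconditioner_eigenvector:
  fixes W :: "real^('d::{finite,linorder})^('k::{finite,linorder})"
  assumes svd: "full_svd W U \<sigma> V"
  shows "is_eigenvector (preconditioner N W) (vectorize (outer (column r U) (column r' V)))
    (\<Sum>j = 1..N. rpow (\<sigma> (pos r)) (2 * ((real N - real j) / real N))
               * rpow (\<sigma> (pos r')) (2 * ((real j - 1) / real N)))"
proof -
  let ?z = "vectorize (outer (column r U) (column r' V))"
  \<comment> \<open>Unit length supplies the nonvanishing required of an eigenvector.\<close>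
  have "?z \<bullet> ?z = 1"
    using svd by (simp add: full_svd_def inner_vectorize_outer inner_columns_orthogonal_matrix)
  then have "?z \<noteq> 0" by auto
  have S: "psd_power (W ** transpose W) s *v column r U = rpow (\<sigma> (pos r)) (2 * s) *\<^sub>R column r U" for s
    using full_svd_psd_power_eigenvector[OF svd] .
  have T: "psd_power (transpose W ** W) s *v column r' V = rpow (\<sigma> (pos r')) (2 * s) *\<^sub>R column r' V" for s
    using full_svd_psd_power_eigenvector[OF full_svd_transpose[OF svd]] by simp
  have "preconditioner N W *v ?z =
      (\<Sum>j = 1..N. rpow (\<sigma> (pos r)) (2 * ((real j - 1) / real N))
                 * rpow (\<sigma> (pos r')) (2 * ((real N - real j) / real N))) *\<^sub>R ?z"
    by (simp only: preconditioner_def sum_matrix_vector_mult kronecker_vectorize_outer S T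
        vectorize_outer_scaleR scaleR_sum_left)
  \<comment> \<open>The reflection \<open>j \<mapsto> N + 1 - j\<close> turns the order of exponents in the update rule into
    the one in the claim.\<close>
  also have "(\<Sum>j = 1..N. rpow (\<sigma> (pos r)) (2 * ((real j - 1) / real N))
                 * rpow (\<sigma> (pos r')) (2 * ((real N - real j) / real N))) =
      (\<Sum>j = 1..N. rpow (\<sigma> (pos r)) (2 * ((real N - real j) / real N))
                 * rpow (\<sigma> (pos r')) (2 * ((real j - 1) / real N)))"
    by (rule sum.reindex_bij_witness[where i = "\<lambda>j. N + 1 - j" and j = "\<lambda>j. N + 1 - j"])
       (auto simp: of_nat_diff)
  finally show ?thesis
    using \<open>?z \<noteq> 0\<close> by (simp add: is_eigenvector_def)
qed

text \<open>The family is orthonormal and has as many members as the dimension of the space, so it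
  is a basis. This justifies calling these "the" eigenvectors: they diagonalise the preconditioner
  completely.\<close>

lemma vectorize_outer_columns_basis:
  fixes U :: "real^'k^'k" and V :: "real^'d^'d"
  assumes U: "orthogonal_matrix U" and V: "orthogonal_matrix V"
  defines "F \<equiv> (\<lambda>(r, r'). vectorize (outer (column r U) (column r' V)))"
  shows "inj F" and "independent (range F)" and "span (range F) = UNIV"
proof -
  have FF: "F p \<bullet> F q = (if p = q then 1 else 0)" for p q
    by (auto simp: F_def case_prod_unfold inner_vectorize_outer inner_columns_orthogonal_matrix U V
        prod_eq_iff)
  show inj: "inj F"
    by (rule injI) (metis FF zero_neq_one)
  have "0 \<notin> range F"
    by (metis FF imageE inner_zero_left zero_neq_one)
  moreover have "pairwise orthogonal (range F)"
    by (auto simp: pairwise_def orthogonal_def FF)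
  ultimately show indep: "independent (range F)"
    by (intro pairwise_orthogonal_independent)
  have "card (range F) = DIM(real^('d \<times> 'k))"
    using inj by (simp add: card_image mult.commute)
  then show "span (range F) = UNIV"
    using indep card_eq_dim[of "range F" UNIV] by (simp add: dim_UNIV top.extremum_unique)
qed

theorem claim1:
  fixes x :: "nat \<Rightarrow> real^('d::{finite,linorder})"
    and y :: "nat \<Rightarrow> real^('k::{finite,linorder})"
    and l :: "real^('k::{finite,linorder}) \<Rightarrow> real^('k::{finite,linorder}) \<Rightarrow> real"
    and L :: "real^('d::{finite,linorder})^('k::{finite,linorder}) \<Rightarrow> real"
    and m N :: nat
    and \<eta> lam :: real
  assumes "N \<ge> 1" and "m \<ge> 1" and "\<eta> > 0" and "lam \<ge> 0"
    and "\<And>u v. l u v \<ge> 0"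
    and "L = training_loss m x y l"
    and "\<And>W. L differentiable (at W)"
  shows "\<exists>P.
    (\<forall>We t.
        We (Suc t) = end_to_end_update \<eta> lam N L (We t) \<longleftrightarrow>
        vectorize (We (Suc t)) =
          (1 - \<eta> * lam * real N) *\<^sub>R vectorize (We t)
          - \<eta> *\<^sub>R (P (We t) *v vectorize (matrix_gradient L (We t)))) \<and>
    (\<forall>W. pos_semidefinite (P W) \<and>
      (\<forall>U \<sigma> V. full_svd W U \<sigma> V \<longrightarrow>
        (\<forall>r r'. is_eigenvector (P W)
            (vectorize (outer (column r U) (column r' V)))
            (\<Sum>j = 1..N. rpow (\<sigma> (pos r)) (2 * ((real N - real j) / real N))
                       * rpow (\<sigma> (pos r')) (2 * ((real j - 1) / real N)))) \<and>
        inj (\<lambda>(r, r'). vectorize (outer (column r U) (column r' V))) \<and>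
        independent (range (\<lambda>(r, r'). vectorize (outer (column r U) (column r' V)))) \<and>
        span (range (\<lambda>(r, r'). vectorize (outer (column r U) (column r' V)))) = UNIV))"
proof (intro exI[of _ "preconditioner N"] conjI allI impI)
  fix We :: "nat \<Rightarrow> real^('d::{finite,linorder})^('k::{finite,linorder})" and t
  show "We (Suc t) = end_to_end_update \<eta> lam N L (We t) \<longleftrightarrow>
      vectorize (We (Suc t)) =
        (1 - \<eta> * lam * real N) *\<^sub>R vectorize (We t)
        - \<eta> *\<^sub>R (preconditioner N (We t) *v vectorize (matrix_gradient L (We t)))"
    \<comment> \<open>Injectivity of \<open>vectorize\<close> gives the direction from the
      vectorized rule back to the matrix rule.\<close>
    by (metis vectorize_end_to_end_update injD inj_vectorize)
next
  fix W :: "real^('d::{finite,linorder})^('k::{finite,linorder})"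
  show "pos_semidefinite (preconditioner N W)"
    by (rule pos_semidefinite_preconditioner)
next
  fix W :: "real^('d::{finite,linorder})^('k::{finite,linorder})" and U \<sigma> V r r'
  assume "full_svd W U \<sigma> V"
  then show "is_eigenvector (preconditioner N W) (vectorize (outer (column r U) (column r' V)))
      (\<Sum>j = 1..N. rpow (\<sigma> (pos r)) (2 * ((real N - real j) / real N))
                 * rpow (\<sigma> (pos r')) (2 * ((real j - 1) / real N)))"
    by (rule full_svd_preconditioner_eigenvector)
next
  fix W :: "real^('d::{finite,linorder})^('k::{finite,linorder})" and U \<sigma> V
  assume "full_svd W U \<sigma> V"
  then have "orthogonal_matrix U" "orthogonal_matrix V"
    by (simp_all add: full_svd_def)
  note basis = vectorize_outer_columns_basis[OF this]
  show "inj (\<lambda>(r, r'). vectorize (outer (column r U) (column r' V)))"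
    by (rule basis)
  show "independent (range (\<lambda>(r, r'). vectorize (outer (column r U) (column r' V))))"
    by (rule basis)
  show "span (range (\<lambda>(r, r'). vectorize (outer (column r U) (column r' V)))) = UNIV"
    by (rule basis)
qed

end
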